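(* Let $G'$ and $H'$ be two non-trivial, connected graphs. Then $$r(G' \boxtimes H') \le rc(G' \boxtimes H') \le 2\,r(G' \boxtimes H') + 2.$$
   Context: All graphs are finite, simple and undirected. A graph is trivial if it has order (number of vertices) 0 or 1, and non-trivial otherwise. For a connected graph $G$: $dist_G(u,v)$ is the length (number of edges) of a shortest path between $u$ and $v$; the eccentricity of a vertex $v$ is $ecc(v)=\max\{dist_G(v,u): u\in V(G)\}$; the radius is $r(G)=\min\{ecc(v): v\in V(G)\}$. An edge coloring of $G$ is any function from $E(G)$ to a set of colors (not necessarily proper). A path is a rainbow path if no two of its edges have the same color. An edge coloring is a rainbow coloring if every pair of vertices is connected by at least one rainbow path. The rainbow connection number $rc(G)$ of a connected graph $G$ is the minimum number of colors in a rainbow coloring of $G$. The strong product $G \boxtimes H$ has vertex set $V(G)\times V(H)$; two distinct vertices $[g_1,h_1]$ and $[g_2,h_2]$ are adjacent if and only if one of the following holds: (1) $g_1=g_2$ and $(h_1,h_2)\in E(H)$; (2) $h_1=h_2$ and $(g_1,g_2)\in E(G)$; (3) $(g_1,g_2)\in E(G)$ and $(h_1,h_2)\in E(H)$. *)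

theory Defs
  imports "Graph_Theory.Graph_Theory"
begin

text \<open>
  Finite simple undirected graphs are the \<open>pair_graph\<close>s of the AFP entry Graph_Theory: finite,
  loop-free, symmetric relations on a vertex set. The undirected edge with ends \<open>u\<close> and \<open>v\<close>
  is represented by both arcs \<open>(u,v)\<close> and \<open>(v,u)\<close>. A path is an \<open>apath\<close>: a list of consecutive
  arcs that visits no vertex twice, so its length is its number of edges.
\<close>

definition trivial_graph :: "'a pair_pre_digraph \<Rightarrow> bool" where
  "trivial_graph G \<longleftrightarrow> card (pverts G) = 0 \<or> card (pverts G) = 1"

text \<open>The next three are meaningful for finite connected nonempty graphs only.\<close>

definition graph_dist :: "'a pair_pre_digraph \<Rightarrow> 'a \<Rightarrow> 'a \<Rightarrow> nat" where
  "graph_dist G u v = (LEAST n. \<exists>p. pre_digraph.apath (with_proj G) u p v \<and> length p = n)"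

definition eccentricity :: "'a pair_pre_digraph \<Rightarrow> 'a \<Rightarrow> nat" where
  "eccentricity G v = Max {graph_dist G v u | u. u \<in> pverts G}"

definition radius :: "'a pair_pre_digraph \<Rightarrow> nat" where
  "radius G = Min {eccentricity G v | v. v \<in> pverts G}"

text \<open>
  A coloring takes the unordered pair \<open>{u,v}\<close>, so that both arcs of an edge get the same color;
  its values outside \<open>edges G\<close> are irrelevant.
\<close>

definition edges :: "'a pair_pre_digraph \<Rightarrow> 'a set set" where
  "edges G = {{u, v} | u v. (u, v) \<in> parcs G}"

definition rainbow_path ::
    "'a pair_pre_digraph \<Rightarrow> ('a set \<Rightarrow> 'c) \<Rightarrow> 'a \<Rightarrow> ('a \<times> 'a) awalk \<Rightarrow> 'a \<Rightarrow> bool" where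
  "rainbow_path G c u p v \<longleftrightarrow>
     pre_digraph.apath (with_proj G) u p v \<and> distinct (map (\<lambda>(x, y). c {x, y}) p)"

definition rainbow_coloring :: "'a pair_pre_digraph \<Rightarrow> ('a set \<Rightarrow> 'c) \<Rightarrow> bool" where
  "rainbow_coloring G c \<longleftrightarrow> (\<forall>u \<in> pverts G. \<forall>v \<in> pverts G. \<exists>p. rainbow_path G c u p v)"

text \<open>
  Colors are natural numbers; this loses nothing since a finite graph uses finitely many colors.
  The minimum exists for finite connected graphs.
\<close>

definition rainbow_connection_number :: "'a pair_pre_digraph \<Rightarrow> nat" where
  "rainbow_connection_number G =
     (LEAST k. \<exists>c :: 'a set \<Rightarrow> nat. rainbow_coloring G c \<and> card (c ` edges G) = k)"

definition strong_product ::
    "'a pair_pre_digraph \<Rightarrow> 'b pair_pre_digraph \<Rightarrow> ('a \<times> 'b) pair_pre_digraph"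
    (infixl \<open>\<boxtimes>\<close> 70) where
  "G \<boxtimes> H = \<lparr> pverts = pverts G \<times> pverts H,
     parcs = {((g1, h1), (g2, h2)) | g1 h1 g2 h2.
       (g1, h1) \<in> pverts G \<times> pverts H \<and> (g2, h2) \<in> pverts G \<times> pverts H \<and>
       (g1, h1) \<noteq> (g2, h2) \<and>
       (g1 = g2 \<and> (h1, h2) \<in> parcs H \<or>
        h1 = h2 \<and> (g1, g2) \<in> parcs G \<or>
        (g1, g2) \<in> parcs G \<and> (h1, h2) \<in> parcs H)} \<rparr>"

end

theory Submission
  imports Defs
begin

text \<open>
  Lower bound: some vertex lies at distance at least the radius \<open>R\<close> from any chosen one, and a
  rainbow path to it uses at least \<open>R\<close> colors.

  Upper bound: split the vertices into two classes, each with a root and a depth function bounded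
  by \<open>R\<close> such that every non-root has a neighbor of smaller depth in its own class and a neighbor
  in the other class, the two roots being adjacent. Color edges inside a class by the larger depth
  of their ends, with disjoint sets of \<open>R\<close> colors for the two classes, the edge between the roots
  by one further color and all other edges between the classes by another. Vertices of different
  classes are joined by going up to one root, over to the other root and down; within one class,
  first go in this way to a neighbor of the target in the other class.

  In the product, let \<open>(g0, h0)\<close> be a center and \<open>i\<close>, \<open>j\<close> the distances in the factors to \<open>g0\<close>
  and \<open>h0\<close>. Diagonal steps preserve the parity of \<open>i + j\<close>, so this parity serves as the class,
  with roots \<open>(g0, h0)\<close> and \<open>(g0, h1)\<close> for a neighbor \<open>h1\<close> of \<open>h0\<close>. Only the odd vertices with
  \<open>j = R\<close> may be too far from \<open>(g0, h1)\<close>; they have \<open>i < R\<close> and are moved to the even class.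
\<close>

subsection \<open>Rainbow walks\<close>

text \<open>The set argument consists of exactly the colors used; vertices may repeat.\<close>

inductive rainbow_walk :: "'a rel \<Rightarrow> ('a set \<Rightarrow> 'c) \<Rightarrow> 'a \<Rightarrow> 'c set \<Rightarrow> 'a \<Rightarrow> bool"
  for E :: "'a rel" and c :: "'a set \<Rightarrow> 'c" where
  Nil: "rainbow_walk E c u {} u"
| Snoc: "rainbow_walk E c u S v \<Longrightarrow> (v, w) \<in> E \<Longrightarrow> c {v, w} \<notin> S
    \<Longrightarrow> rainbow_walk E c u (insert (c {v, w}) S) w"

lemma rainbow_walk_edge: "(v, w) \<in> E \<Longrightarrow> rainbow_walk E c v {c {v, w}} w"
  using Snoc[OF Nil] by fastforce

text \<open>The second walk is the first premise because the induction runs over it; disjointness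
  keeps each appended color new.\<close>

lemma rainbow_walk_trans:
  assumes "rainbow_walk E c v T w" "rainbow_walk E c u S v" "S \<inter> T = {}"
  shows "rainbow_walk E c u (S \<union> T) w"
  using assms
proof (induction rule: rainbow_walk.induct)
  case (Snoc v' T x w)
  then have "rainbow_walk E c u (insert (c {x, w}) (S \<union> T)) w"
    by (intro rainbow_walk.Snoc) auto
  then show ?case by simp
qed simp

lemma rainbow_walk_sym:
  assumes "rainbow_walk E c u S v" "sym E"
  shows "rainbow_walk E c v S u"
  using assms
proof (induction rule: rainbow_walk.induct)
  case (Snoc u S v w)
  then have "rainbow_walk E c w {c {w, v}} v"
    by (intro rainbow_walk_edge) (auto dest: symD)
  then have "rainbow_walk E c w ({c {w, v}} \<union> S) u"
    using Snoc by (intro rainbow_walk_trans) (auto simp: insert_commute)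
  then show ?case by (simp add: insert_commute)
qed (rule Nil)

text \<open>The color set stays in the conclusion so that the induction knows the color of the
  appended edge to be new.\<close>

lemma awalk_of_rainbow_walk:
  assumes "rainbow_walk (parcs X) c u S v" "pair_wf_digraph X" "u \<in> pverts X"
  shows "\<exists>p. pre_digraph.awalk (with_proj X) u p v \<and> distinct (map (\<lambda>(x, y). c {x, y}) p)
    \<and> set (map (\<lambda>(x, y). c {x, y}) p) = S"
  using assms
proof (induction rule: rainbow_walk.induct)
  case (Nil u)
  interpret pair_wf_digraph X by fact
  show ?case using Nil by (intro exI[of _ "[]"]) (auto simp: awalk_Nil_iff)
next
  case (Snoc u S v w)
  interpret pair_wf_digraph X by fact
  obtain p where p: "awalk u p v" "distinct (map (\<lambda>(x, y). c {x, y}) p)"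
    "set (map (\<lambda>(x, y). c {x, y}) p) = S"
    using Snoc by auto
  have "awalk v [(v, w)] w"
    using Snoc.hyps(2) by (auto simp: awalk_simps dest: in_arcsD1 in_arcsD2)
  then have "awalk u (p @ [(v, w)]) w" using p(1) by (rule awalk_appendI[rotated])
  then show ?case using p Snoc by (intro exI[of _ "p @ [(v, w)]"]) auto
qed

text \<open>Cutting out cycles only drops edges, so the colors stay distinct. Hence it suffices to
  construct walks.\<close>

lemma rainbow_path_of_rainbow_walk:
  assumes "rainbow_walk (parcs X) c u S v" "pair_wf_digraph X" "u \<in> pverts X"
  shows "\<exists>p. rainbow_path X c u p v"
proof -
  interpret pair_wf_digraph X by fact
  obtain p where p: "awalk u p v" "distinct (map (\<lambda>(x, y). c {x, y}) p)"
    using awalk_of_rainbow_walk[OF assms] by auto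
  let ?q = "awalk_to_apath p"
  have q: "apath u ?q v" using p(1) by (rule apath_awalk_to_apath)
  have "set ?q \<subseteq> set p" using p(1) by (rule awalk_to_apath_subset)
  then have "inj_on (\<lambda>(x, y). c {x, y}) (set ?q)"
    using p(2) by (meson distinct_map inj_on_subset)
  moreover have "distinct ?q"
    using q distinct_verts_imp_distinct by (auto simp: apath_def)
  ultimately have "distinct (map (\<lambda>(x, y). c {x, y}) ?q)" by (simp add: distinct_map)
  then show ?thesis using q unfolding rainbow_path_def by blast
qed

subsection \<open>Colorings from a splitting of the vertices into two classes\<close>

text \<open>\<open>s\<close> tells the classes apart. The depth \<open>d\<close> need not be a
  distance: \<open>descend\<close> only asks that it drop.\<close>

locale vertex_split =
  fixes X :: "'a pair_pre_digraph" and s :: "'a \<Rightarrow> bool" and d :: "'a \<Rightarrow> nat"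
    and a b :: 'a and R :: nat
  assumes graph: "pair_graph X"
    and root_edge: "(a, b) \<in> parcs X"
    and class_a: "s a" and class_b: "\<not> s b"
    and depth_le: "v \<in> pverts X \<Longrightarrow> d v \<le> R"
    and depth_0: "v \<in> pverts X \<Longrightarrow> d v = 0 \<longleftrightarrow> v = a \<or> v = b"
    and descend: "v \<in> pverts X \<Longrightarrow> d v > 0 \<Longrightarrow> \<exists>w. (v, w) \<in> parcs X \<and> (s w \<longleftrightarrow> s v) \<and> d w < d v"
    and cross: "v \<in> pverts X \<Longrightarrow> d v > 0 \<Longrightarrow> \<exists>w. (v, w) \<in> parcs X \<and> (s w \<longleftrightarrow> \<not> s v)"
begin

sublocale pair_graph X by (rule graph)

lemma sym_E: "sym (parcs X)"
  using arcs_symmetric by (auto intro: symI)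

text \<open>Each class has a single vertex of depth 0, so edges inside the classes get colors in
  \<open>{1..R}\<close> and \<open>{R + 1..2 * R}\<close>, and color 0 is left to the root
  edge.\<close>

definition split_color :: "'a set \<Rightarrow> nat" where
  "split_color e = (if e = {a, b} then 0 else if \<forall>x\<in>e. s x then Max (d ` e)
    else if \<forall>x\<in>e. \<not> s x then R + Max (d ` e) else 2 * R + 1)"

definition root where "root t = (if t then a else b)"

definition palette :: "bool \<Rightarrow> nat set" where
  "palette t = (if t then {1..R} else {R + 1..2 * R})"

lemma root_eq: "v \<in> pverts X \<Longrightarrow> d v = 0 \<Longrightarrow> v = root (s v)"
  using depth_0 class_a class_b by (auto simp: root_def)

lemma split_color_le: "e \<in> edges X \<Longrightarrow> split_color e \<le> 2 * R + 1"
proof -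
  assume "e \<in> edges X"
  then obtain u v where uv: "e = {u, v}" "(u, v) \<in> parcs X" by (auto simp: edges_def)
  then have "d u \<le> R" "d v \<le> R" using depth_le in_arcsD1 in_arcsD2 by blast+
  then show ?thesis unfolding split_color_def uv(1) by auto
qed

text \<open>The color of a descending edge is fixed by its deeper end, so colors decrease along the
  walk. The bound by \<open>d v\<close> instead of \<open>R\<close> is what makes the new color
  fresh in the induction.\<close>

lemma walk_to_root:
  assumes "v \<in> pverts X"
  shows "\<exists>S. rainbow_walk (parcs X) split_color v S (root (s v)) \<and>
    S \<subseteq> (if s v then {1..d v} else {R + 1..R + d v})"
  using assms
proof (induction "d v" arbitrary: v rule: less_induct)
  case less
  show ?case
  proof (cases "d v = 0")
    case True
    then show ?thesis using root_eq[OF less.prems] rainbow_walk.Nil by fastforce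
  next
    case False
    then obtain w where w: "(v, w) \<in> parcs X" "s w = s v" "d w < d v"
      using descend less.prems by blast
    have "w \<in> pverts X" using w(1) by (rule in_arcsD2)
    then obtain S where S: "rainbow_walk (parcs X) split_color w S (root (s v))"
      "S \<subseteq> (if s v then {1..d w} else {R + 1..R + d w})"
      using less.hyps[OF w(3)] w(2) by auto
    \<comment> \<open>The root edge joins different classes.\<close>
    have "{v, w} \<noteq> {a, b}" using w(2) class_a class_b by (auto simp: doubleton_eq_iff)
    then have col: "split_color {v, w} = (if s v then d v else R + d v)"
      using w by (auto simp: split_color_def)
    have "{split_color {v, w}} \<inter> S = {}" using S(2) w(3) by (auto simp: col split: if_splits)
    then have "rainbow_walk (parcs X) split_color v ({split_color {v, w}} \<union> S) (root (s v))"
      using rainbow_walk_trans[OF S(1) rainbow_walk_edge[OF w(1)]] by blast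
    moreover have "{split_color {v, w}} \<union> S \<subseteq> (if s v then {1..d v} else {R + 1..R + d v})"
      using S(2) w(3) False by (auto simp: col split: if_splits)
    ultimately show ?thesis by blast
  qed
qed

lemma walk_to_root_palette:
  assumes "v \<in> pverts X"
  obtains S where "rainbow_walk (parcs X) split_color v S (root (s v))" "S \<subseteq> palette (s v)"
proof -
  obtain S where S: "rainbow_walk (parcs X) split_color v S (root (s v))"
    "S \<subseteq> (if s v then {1..d v} else {R + 1..R + d v})"
    using walk_to_root[OF assms] by blast
  have "S \<subseteq> palette (s v)"
    using S(2) depth_le[OF assms] by (fastforce simp: palette_def split: if_splits)
  with S(1) show thesis by (rule that)
qed

text \<open>The two palettes are disjoint and the root edge adds color 0. The bound
  \<open>2 * R\<close> leaves \<open>2 * R + 1\<close> free for one more edge.\<close>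

lemma walk_between_classes:
  assumes "u \<in> pverts X" "v \<in> pverts X" "s u \<noteq> s v"
  obtains S where "rainbow_walk (parcs X) split_color u S v" "S \<subseteq> {0..2 * R}"
proof -
  obtain S where S: "rainbow_walk (parcs X) split_color u S (root (s u))" "S \<subseteq> palette (s u)"
    using walk_to_root_palette[OF assms(1)] .
  obtain T where T: "rainbow_walk (parcs X) split_color v T (root (s v))" "T \<subseteq> palette (s v)"
    using walk_to_root_palette[OF assms(2)] .
  have "(root (s u), root (s v)) \<in> parcs X"
    using assms(3) root_edge arcs_symmetric by (auto simp: root_def)
  moreover have "split_color {root (s u), root (s v)} = 0"
    using assms(3) by (auto simp: split_color_def root_def insert_commute)
  ultimately have "rainbow_walk (parcs X) split_color (root (s u)) {0} (root (s v))"
    using rainbow_walk_edge by metis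
  then have "rainbow_walk (parcs X) split_color u (S \<union> {0}) (root (s v))"
    using S by (intro rainbow_walk_trans) (auto simp: palette_def split: if_splits)
  then have "rainbow_walk (parcs X) split_color u ((S \<union> {0}) \<union> T) v"
    using S(2) T(2) assms(3)
    by (intro rainbow_walk_trans[OF rainbow_walk_sym[OF T(1) sym_E]])
      (fastforce simp: palette_def split: if_splits)+
  moreover have "(S \<union> {0}) \<union> T \<subseteq> {0..2 * R}"
    using S(2) T(2) by (fastforce simp: palette_def split: if_splits)
  ultimately show thesis by (rule that)
qed

text \<open>Inside one class the last edge enters from the other class with the free color
  \<open>2 * R + 1\<close>; a target that is a root is reached by descent alone.\<close>

lemma walk_between:
  assumes "u \<in> pverts X" "v \<in> pverts X"
  shows "\<exists>S. rainbow_walk (parcs X) split_color u S v"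
proof (cases "s u = s v")
  case False
  then show ?thesis using walk_between_classes[OF assms] by blast
next
  case True
  show ?thesis
  proof (cases "d v = 0")
    case True
    then show ?thesis
      using walk_to_root[OF assms(1)] root_eq[OF assms(2)] \<open>s u = s v\<close> by metis
  next
    case False
    then obtain w where w: "(v, w) \<in> parcs X" "s w \<longleftrightarrow> \<not> s v" using cross assms(2) by blast
    have wX: "w \<in> pverts X" using w(1) by (rule in_arcsD2)
    obtain S where S: "rainbow_walk (parcs X) split_color u S w" "S \<subseteq> {0..2 * R}"
      using walk_between_classes[OF assms(1) wX] w(2) True by blast
    have "v \<noteq> a" "v \<noteq> b" using False depth_0[OF assms(2)] by auto
    then have "split_color {w, v} = 2 * R + 1"
      using w(2) by (auto simp: split_color_def doubleton_eq_iff)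
    moreover have "(w, v) \<in> parcs X" using w(1) by (rule arcs_symmetric)
    ultimately have "rainbow_walk (parcs X) split_color u (insert (2 * R + 1) S) v"
      using rainbow_walk.Snoc[OF S(1)] S(2) by fastforce
    then show ?thesis by blast
  qed
qed

lemma exists_rainbow_coloring:
  "\<exists>c :: 'a set \<Rightarrow> nat. rainbow_coloring X c \<and> card (c ` edges X) \<le> 2 * R + 2"
proof (intro exI conjI)
  show "rainbow_coloring X split_color"
    unfolding rainbow_coloring_def
  proof (intro ballI)
    fix u v
    assume uv: "u \<in> pverts X" "v \<in> pverts X"
    then obtain S where "rainbow_walk (parcs X) split_color u S v" using walk_between by blast
    then show "\<exists>p. rainbow_path X split_color u p v"
      by (rule rainbow_path_of_rainbow_walk[OF _ pair_wf_digraph uv(1)])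
  qed
next
  have "split_color ` edges X \<subseteq> {0..2 * R + 1}" using split_color_le by auto
  then show "card (split_color ` edges X) \<le> 2 * R + 2"
    using card_mono[of "{0..2 * R + 1}" "split_color ` edges X"] by simp
qed

end

subsection \<open>Distances\<close>

text \<open>Relational powers allow repeated vertices, which projections of paths to a factor may
  have.\<close>

lemma relpow_of_awalk:
  assumes "pair_wf_digraph X" "pre_digraph.awalk (with_proj X) u p v"
  shows "(u, v) \<in> parcs X ^^ length p"
  using assms(2)
proof (induction p arbitrary: u)
  interpret pair_wf_digraph X by fact
  case Nil
  then show ?case by (simp add: awalk_Nil_iff)
next
  interpret pair_wf_digraph X by fact
  case (Cons e p)
  then show ?case by (cases e) (auto simp: awalk_Cons_iff simp del: relpow.simps intro: relpow_Suc_I2)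
qed

lemma graph_dist_le:
  "pre_digraph.apath (with_proj X) u p v \<Longrightarrow> graph_dist X u v \<le> length p"
  unfolding graph_dist_def by (rule Least_le) blast

text \<open>Reachability provides a path, so the \<open>LEAST\<close> in \<open>graph_dist\<close>
  is attained.\<close>

lemma apath_length_graph_dist:
  assumes "pair_wf_digraph X" "u \<in> pverts X" "(u, v) \<in> (parcs X)\<^sup>*"
  shows "\<exists>p. pre_digraph.apath (with_proj X) u p v \<and> length p = graph_dist X u v"
proof -
  interpret pair_wf_digraph X by fact
  have "\<exists>p. awalk u p v"
    using assms(3)
  proof (induction rule: rtrancl_induct)
    case base
    show ?case using assms(2) by (intro exI[of _ "[]"]) (auto simp: awalk_Nil_iff)
  next
    case (step y z)
    then obtain p where "awalk u p y" by blast
    moreover have "awalk y [(y, z)] z"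
      using step by (auto simp: awalk_simps dest: in_arcsD1 in_arcsD2)
    ultimately show ?case by (blast intro: awalk_appendI)
  qed
  then obtain p where "apath u p v" using apath_awalk_to_apath by blast
  then have "\<exists>n p. apath u p v \<and> length p = n" by blast
  then show ?thesis unfolding graph_dist_def by (rule LeastI_ex)
qed

text \<open>Connectedness is defined through the symmetric closure, which adds nothing to a
  symmetric graph.\<close>

lemma rtrancl_of_connected:
  assumes "pair_graph G" "Digraph_Component.connected (with_proj G)"
    "u \<in> pverts G" "v \<in> pverts G"
  shows "(u, v) \<in> (parcs G)\<^sup>*"
proof -
  interpret pair_graph G by fact
  have "u \<rightarrow>\<^sup>*\<^bsub>with_proj (mk_symmetric (with_proj G))\<^esub> v"
    using assms by (auto simp: Digraph_Component.connected_def)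
  then have "u \<rightarrow>\<^sup>*\<^bsub>with_proj G\<^esub> v"
    using reachable_mk_symmetric_eq sym_arcs by blast
  then show ?thesis by (simp add: reachable_conv)
qed

section \<open>Breadth-first layers around a root\<close>

locale rooted_layers =
  fixes V :: "'a set" and E :: "'a rel" and R :: nat
    and r r1 :: 'a and d :: "'a \<Rightarrow> nat" and p :: "'a \<Rightarrow> 'a"
  assumes E_sub: "E \<subseteq> V \<times> V" and E_sym: "sym E"
    and root_in: "r \<in> V" and child: "(r, r1) \<in> E" "d r1 = 1"
    and depth_le: "v \<in> V \<Longrightarrow> d v \<le> R" and depth_0: "v \<in> V \<Longrightarrow> d v = 0 \<longleftrightarrow> v = r"
    and parent: "v \<in> V \<Longrightarrow> d v > 0 \<Longrightarrow> (v, p v) \<in> E"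
      "v \<in> V \<Longrightarrow> d v > 0 \<Longrightarrow> d (p v) = d v - 1"
begin

lemma child_in: "r1 \<in> V" using child E_sub by auto

lemma parent_in: "v \<in> V \<Longrightarrow> d v > 0 \<Longrightarrow> p v \<in> V" using parent E_sub by auto

lemma depth_root: "d r = 0" using depth_0 root_in by blast

lemma R_pos: "R > 0" using child_in child depth_le by fastforce

text \<open>A step to the parent changes the parity of the depth; the root steps to
  \<open>r1\<close> instead.\<close>

lemma flip:
  assumes "v \<in> V"
  obtains w where "w \<in> V" "(v, w) \<in> E" "even (d w) \<longleftrightarrow> odd (d v)"
proof (cases "d v = 0")
  case True
  then have "v = r" using depth_0 assms by blast
  then show thesis using that[of r1] child_in child depth_root by simp
next
  case False
  then show thesis using that[of "p v"] parent parent_in assms by simp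
qed

end

text \<open>The depth is the distance from \<open>r\<close>. \<open>R\<close> is only an upper
  bound, since the radius of the product will serve for both factors.\<close>

lemma rooted_layers_exists:
  assumes "E \<subseteq> V \<times> V" "sym E" "r \<in> V" "x \<in> V" "x \<noteq> r"
    and reach: "\<And>v. v \<in> V \<Longrightarrow> \<exists>n\<le>R. (r, v) \<in> E ^^ n"
  obtains r1 d p where "rooted_layers V E R r r1 d p"
proof -
  define d where "d v = (LEAST n. (r, v) \<in> E ^^ n)" for v
  have d: "(r, v) \<in> E ^^ d v" if "v \<in> V" for v
    using LeastI_ex reach[OF that] unfolding d_def by metis
  have d_le: "d v \<le> n" if "(r, v) \<in> E ^^ n" for v n
    using that unfolding d_def by (rule Least_le)
  have parent: "\<exists>u. (v, u) \<in> E \<and> d u = d v - 1" if v: "v \<in> V" "d v > 0" for v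
  proof -
    \<comment> \<open>The vertex before \<open>v\<close> on a shortest walk has depth at most
      \<open>d v - 1\<close>; extending a shortest walk to it gives equality.\<close>
    have "(r, v) \<in> E ^^ Suc (d v - 1)" using d v by simp
    then obtain u where u: "(r, u) \<in> E ^^ (d v - 1)" "(u, v) \<in> E" by auto
    then have "u \<in> V" using assms(1) by auto
    have "(r, v) \<in> E ^^ Suc (d u)" using d[OF \<open>u \<in> V\<close>] u(2) by auto
    then have "d v \<le> Suc (d u)" by (rule d_le)
    then show ?thesis using d_le[OF u(1)] u(2) assms(2) by (auto dest: symD intro!: exI[of _ u])
  qed
  define p where "p v = (SOME u. (v, u) \<in> E \<and> d u = d v - 1)" for v
  have p: "(v, p v) \<in> E \<and> d (p v) = d v - 1" if "v \<in> V" "d v > 0" for v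
    unfolding p_def using parent[OF that] by (rule someI_ex)
  have d0: "d v = 0 \<longleftrightarrow> v = r" if "v \<in> V" for v
    using d[OF that] d_le[of v 0] by auto
  have "\<exists>y\<in>V. d y = 1"
  proof -
    \<comment> \<open>Parents lower the depth by exactly one, so depth 1 is not skipped.\<close>
    have "\<exists>y\<in>V. d y = 1" if "y \<in> V" "d y > 0" for y
      using that
    proof (induction "d y" arbitrary: y rule: less_induct)
      case (less y)
      have "p y \<in> V" using p[OF less.prems] assms(1) by auto
      then show ?case using p[OF less.prems] less.hyps[of "p y"] less.prems
        by (cases "d y = 1") auto
    qed
    then show ?thesis using d0[OF assms(4)] assms(4,5) by blast
  qed
  then obtain r1 where r1: "r1 \<in> V" "d r1 = 1" by blast
  then have "p r1 = r" using p[of r1] d0[of "p r1"] assms(1) by auto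
  then have "(r, r1) \<in> E" using p[of r1] r1 assms(2) by (auto dest: symD)
  moreover have "d v \<le> R" if "v \<in> V" for v using reach[OF that] d_le by (meson le_trans)
  ultimately have "rooted_layers V E R r r1 d p"
    using assms r1 d0 p by unfold_locales auto
  then show thesis by (rule that)
qed

subsection \<open>Strong products\<close>

lemma pverts_strong_product [simp]: "pverts (G \<boxtimes> H) = pverts G \<times> pverts H"
  by (simp add: strong_product_def)

text \<open>Absence of loops in the factors gives the distinctness of the ends.\<close>

lemma in_parcs_strong_product:
  assumes "pair_graph G" "pair_graph H"
  shows "((g, h), (g', h')) \<in> parcs (G \<boxtimes> H) \<longleftrightarrow>
    g = g' \<and> g \<in> pverts G \<and> (h, h') \<in> parcs H \<or>
    h = h' \<and> h \<in> pverts H \<and> (g, g') \<in> parcs G \<or>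
    (g, g') \<in> parcs G \<and> (h, h') \<in> parcs H"
proof -
  interpret G: pair_graph G by fact
  interpret H: pair_graph H by fact
  show ?thesis
    by (auto simp: strong_product_def dest: G.in_arcsD1 G.in_arcsD2 H.in_arcsD1 H.in_arcsD2
        G.no_loops' H.no_loops')
qed

lemma pair_graph_strong_product:
  assumes "pair_graph G" "pair_graph H"
  shows "pair_graph (G \<boxtimes> H)"
proof -
  interpret G: pair_graph G by fact
  interpret H: pair_graph H by fact
  note arc = in_parcs_strong_product[OF assms]
  have sub: "parcs (G \<boxtimes> H) \<subseteq> pverts (G \<boxtimes> H) \<times> pverts (G \<boxtimes> H)"
    by (auto simp: strong_product_def)
  have fin: "finite (pverts (G \<boxtimes> H))"
    using G.pair_finite_verts H.pair_finite_verts by simp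
  show ?thesis
  proof unfold_locales
    show "finite (parcs (G \<boxtimes> H))" using sub fin by (meson finite_SigmaI finite_subset)
    show "symmetric (with_proj (G \<boxtimes> H))"
      unfolding symmetric_def
      by (auto simp: arc intro!: symI dest: G.arcs_symmetric H.arcs_symmetric)
    show "fst e \<noteq> snd e" if "e \<in> parcs (G \<boxtimes> H)" for e
      using that by (auto simp: strong_product_def)
  qed (use sub fin in auto)
qed

text \<open>Each step of the product moves a coordinate along an edge or leaves it fixed.\<close>

lemma relpow_strong_product:
  assumes "((g0, h0), (g, h)) \<in> parcs (G \<boxtimes> H) ^^ n"
  shows "(\<exists>m\<le>n. (g0, g) \<in> parcs G ^^ m) \<and> (\<exists>m\<le>n. (h0, h) \<in> parcs H ^^ m)"
  using assms
proof (induction n arbitrary: g h)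
  case 0
  then show ?case by auto
next
  case (Suc n)
  then obtain g' h' where step: "((g0, h0), (g', h')) \<in> parcs (G \<boxtimes> H) ^^ n"
    "((g', h'), (g, h)) \<in> parcs (G \<boxtimes> H)" by auto
  have "g' = g \<or> (g', g) \<in> parcs G" "h' = h \<or> (h', h) \<in> parcs H"
    using step(2) by (auto simp: strong_product_def)
  moreover obtain k l where "k \<le> n" "(g0, g') \<in> parcs G ^^ k" "l \<le> n" "(h0, h') \<in> parcs H ^^ l"
    using Suc.IH[OF step(1)] by blast
  ultimately show ?case by (meson Suc_le_mono le_SucI relpow_Suc_I)
qed

text \<open>Move the first coordinate, then the second.\<close>

lemma rtrancl_strong_product:
  assumes "pair_graph G" "pair_graph H" and "(g, g') \<in> (parcs G)\<^sup>*" "(h, h') \<in> (parcs H)\<^sup>*"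
    and "g' \<in> pverts G" "h \<in> pverts H"
  shows "((g, h), (g', h')) \<in> (parcs (G \<boxtimes> H))\<^sup>*"
proof -
  note arc = in_parcs_strong_product[OF assms(1,2)]
  have "((g, h), (g', h)) \<in> (parcs (G \<boxtimes> H))\<^sup>*"
    using assms(3)
    by (induction rule: rtrancl_induct)
      (use assms(6) in \<open>auto simp: arc intro: rtrancl_into_rtrancl\<close>)
  also have "((g', h), (g', h')) \<in> (parcs (G \<boxtimes> H))\<^sup>*"
    using assms(4)
    by (induction rule: rtrancl_induct)
      (use assms(5) in \<open>auto simp: arc intro: rtrancl_into_rtrancl\<close>)
  finally show ?thesis .
qed

lemma strong_product_vertex_split:
  fixes G :: "'a pair_pre_digraph" and H :: "'b pair_pre_digraph"
  assumes "pair_graph G" "pair_graph H"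
    and "rooted_layers (pverts G) (parcs G) R g0 g1 i p"
    and "rooted_layers (pverts H) (parcs H) R h0 h1 j q"
  shows "\<exists>s d. vertex_split (G \<boxtimes> H) s d (g0, h0) (g0, h1) R"
proof -
  interpret G: rooted_layers "pverts G" "parcs G" R g0 g1 i p by fact
  interpret H: rooted_layers "pverts H" "parcs H" R h0 h1 j q by fact
  note arc = in_parcs_strong_product[OF assms(1,2)]
  \<comment> \<open>The vertex \<open>(g0, h1)\<close> is excluded explicitly because for
    \<open>R = 1\<close> it is itself odd with \<open>j h1 = R\<close>.\<close>
  define s where "s = (\<lambda>(g, h). (g, h) \<noteq> (g0, h1) \<and> (even (i g + j h) \<or> j h = R))"
  \<comment> \<open>These values bound the number of diagonal steps to the root. For odd vertices
    with \<open>i g < j h\<close> the descent may end at a neighbor of \<open>h0\<close> other than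
    \<open>h1\<close>; the detour over layers (1, 0) costs the extra 1.\<close>
  define d where "d = (\<lambda>(g, h). if (g, h) = (g0, h1) then 0
     else if even (i g + j h) \<or> j h = R then max (i g) (j h)
     else if i g > j h then i g else j h + 1)"
  have diff: "h1 \<noteq> h0" using H.depth_root H.child by auto
  have le: "i g \<le> R \<and> j h \<le> R" if "g \<in> pverts G" "h \<in> pverts H" for g h
    using that G.depth_le H.depth_le by blast
  \<comment> \<open>The value \<open>j h + 1\<close> occurs only for \<open>j h < R\<close>; this is
    why the odd vertices with \<open>j h = R\<close> are moved.\<close>
  have bound: "d v \<le> R" if "v \<in> pverts (G \<boxtimes> H)" for v
    using that le by (cases v) (fastforce simp: d_def le_less)
  have zero: "d v = 0 \<longleftrightarrow> v = (g0, h0) \<or> v = (g0, h1)" if v: "v \<in> pverts (G \<boxtimes> H)" for v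
  proof -
    obtain g h where gh: "v = (g, h)" "g \<in> pverts G" "h \<in> pverts H" using v by auto
    have "i g = 0 \<longleftrightarrow> g = g0" "j h = 0 \<longleftrightarrow> h = h0"
      using G.depth_0[OF gh(2)] H.depth_0[OF gh(3)] by auto
    then show ?thesis using H.R_pos by (auto simp: d_def gh(1))
  qed
  have even_class: "s (g, h) \<and> d (g, h) = max (i g) (j h)" if "even (i g + j h)" for g h
    using that G.depth_root H.child by (auto simp: s_def d_def)
  \<comment> \<open>Only an inequality: \<open>(g0, h1)\<close> has depth 0, where the formula gives
    2.\<close>
  have odd_class: "\<not> s (g, h) \<and> d (g, h) \<le> (if i g > j h then i g else j h + 1)"
    if "odd (i g + j h)" "j h \<noteq> R" for g h
    using that by (auto simp: s_def d_def)
  have cross: "\<exists>w. (v, w) \<in> parcs (G \<boxtimes> H) \<and> (s w \<longleftrightarrow> \<not> s v)"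
    if v: "v \<in> pverts (G \<boxtimes> H)" "d v > 0" for v
  proof -
    obtain g h where gh: "v = (g, h)" "g \<in> pverts G" "h \<in> pverts H" using v(1) by auto
    have nb: "(g, h) \<noteq> (g0, h1)" using v(2) gh(1) by (auto simp: d_def)
    obtain g' where g': "g' \<in> pverts G" "(g, g') \<in> parcs G" "even (i g') \<longleftrightarrow> odd (i g)"
      using G.flip[OF gh(2)] .
    show ?thesis
    proof (cases "j h = R")
      case False
      have "s (g', h) \<longleftrightarrow> \<not> s v"
        using even_class[of g h] even_class[of g' h] odd_class[of g h] odd_class[of g' h] False g' gh(1)
        by (cases "even (i g + j h)") auto
      moreover have "(v, (g', h)) \<in> parcs (G \<boxtimes> H)" using g' gh by (simp add: arc)
      ultimately show ?thesis by blast
    next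
      case True
      then have q: "q h \<in> pverts H" "(h, q h) \<in> parcs H" "j (q h) = R - 1"
        using H.parent[OF gh(3)] H.parent_in[OF gh(3)] H.R_pos by auto
      \<comment> \<open>The second coordinate drops by one, so the first changes parity exactly when
        the sum was odd.\<close>
      define x where "x = (if even (i g + j h) then g else g')"
      have "odd (i x + j (q h))" using g' q True H.R_pos by (auto simp: x_def)
      moreover have "j (q h) \<noteq> R" using q H.R_pos by simp
      ultimately have "\<not> s (x, q h)" using odd_class by blast
      moreover have "s v" using nb True gh(1) by (auto simp: s_def)
      moreover have "(v, (x, q h)) \<in> parcs (G \<boxtimes> H)"
        using g' gh q by (simp add: arc x_def)
      ultimately show ?thesis by blast
    qed
  qed
  have descend: "\<exists>w. (v, w) \<in> parcs (G \<boxtimes> H) \<and> (s w \<longleftrightarrow> s v) \<and> d w < d v"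
    if v: "v \<in> pverts (G \<boxtimes> H)" "d v > 0" for v
  proof -
    obtain g h where gh: "v = (g, h)" "g \<in> pverts G" "h \<in> pverts H" using v(1) by auto
    have nb: "(g, h) \<noteq> (g0, h1)" using v(2) gh(1) by (auto simp: d_def)
    note bd = le[OF gh(2,3)]
    \<comment> \<open>A coordinate at its root bounces to layer 1, so both parities change and the
      class parity is kept.\<close>
    define x where "x = (if i g > 0 then p g else g1)"
    define y where "y = (if j h > 0 then q h else h1)"
    have x: "(g, x) \<in> parcs G" "i x = (if i g > 0 then i g - 1 else 1)"
      using G.parent[OF gh(2)] G.child G.depth_0[OF gh(2)] by (auto simp: x_def)
    have y: "(h, y) \<in> parcs H" "j y = (if j h > 0 then j h - 1 else 1)"
      using H.parent[OF gh(3)] H.child H.depth_0[OF gh(3)] by (auto simp: y_def)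
    have xy: "(v, (x, y)) \<in> parcs (G \<boxtimes> H)" using x y gh by (simp add: arc)
    have parity: "even (i x + j y) \<longleftrightarrow> even (i g + j h)" using x(2) y(2) by auto
    consider (even) "even (i g + j h)" | (top) "odd (i g + j h)" "j h = R"
      | (odd) "odd (i g + j h)" "j h < R" using bd by linarith
    then show ?thesis
    proof cases
      case even
      \<comment> \<open>A nonzero even sum is at least 2, so a coordinate bouncing from 0 to 1 stays
        below the old maximum.\<close>
      then have "i g + j h \<noteq> 1" by (metis odd_one)
      moreover have "\<not> (i g = 0 \<and> j h = 0)"
        using v(2) even_class[OF even] gh(1) by auto
      ultimately have "max (i x) (j y) < max (i g) (j h)"
        using x(2) y(2) by (auto simp: max_def split: if_splits)
      then show ?thesis
        using xy even_class[OF even] even_class[of x y] parity even gh(1)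
        by (intro exI[of _ "(x, y)"]) auto
    next
      case top
      then have q: "(h, q h) \<in> parcs H" "j (q h) = R - 1"
        using H.parent[OF gh(3)] H.R_pos by auto
      \<comment> \<open>With \<open>i g = R\<close> the sum would be \<open>2 * R\<close>. Hence
        lowering the second coordinate alone lowers the maximum and leads to an even vertex.\<close>
      have "i g \<noteq> R" using top by auto
      then have "i g < R" using bd by simp
      have ev: "even (i g + j (q h))" using q top H.R_pos by auto
      have "s v" "d v = R" using nb top gh(1) bd by (auto simp: s_def d_def)
      moreover have "max (i g) (j (q h)) < R" using \<open>i g < R\<close> q H.R_pos by simp
      moreover have "(v, (g, q h)) \<in> parcs (G \<boxtimes> H)" using gh q by (simp add: arc)
      ultimately show ?thesis using even_class[OF ev] by (intro exI[of _ "(g, q h)"]) auto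
    next
      case odd
      have dv: "\<not> s v" "d v = (if i g > j h then i g else j h + 1)"
        using nb odd gh(1) by (auto simp: s_def d_def)
      show ?thesis
      \<comment> \<open>Here the step reaches the root \<open>(g0, h1)\<close>, for which
        \<open>odd_class\<close> is too weak, or inapplicable if \<open>R = 1\<close>.\<close>
      proof (cases "i g = 1 \<and> j h = 0")
        case True
        then have "h = h0" using H.depth_0[OF gh(3)] by blast
        moreover have "p g = g0" "(g, p g) \<in> parcs G"
          using True G.parent[OF gh(2)] G.depth_0 G.parent_in[OF gh(2)] by auto
        ultimately have "(v, (g0, h1)) \<in> parcs (G \<boxtimes> H)" using H.child gh(1) by (simp add: arc)
        moreover have "\<not> s (g0, h1)" "d (g0, h1) = 0" by (auto simp: s_def d_def)
        ultimately show ?thesis using dv(1) v(2) by (intro exI[of _ "(g0, h1)"]) auto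
      next
        case False
        \<comment> \<open>A bounce to \<open>j y = 1\<close> needs \<open>j h = 0\<close>, and then
          \<open>i g\<close> is odd and at least 3, so \<open>R\<close> exceeds 1.\<close>
        have "j y \<noteq> R" using odd False y(2) bd by (auto split: if_splits elim: oddE)
        then have w: "\<not> s (x, y)" "d (x, y) \<le> (if i x > j y then i x else j y + 1)"
          using odd_class[of x y] parity odd(1) by auto
        \<comment> \<open>Outside layers (0, 1) the larger coordinate stays the larger one and drops
          by one; from (0, 1) the step leads to (1, 0), from depth 2 to at most 1.\<close>
        have "i g \<noteq> j h" using odd(1) by auto
        moreover have "i g \<noteq> 2 \<or> j h \<noteq> 0" using odd(1) by (cases "j h = 0") auto
        moreover have "i g \<noteq> 0 \<or> j h \<noteq> 2" using odd(1) by (cases "i g = 0") auto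
        ultimately have "d (x, y) < d v"
          using w(2) dv(2) x(2) y(2) False by (auto split: if_splits)
        then show ?thesis using xy w(1) dv(1) by blast
      qed
    qed
  qed
  have "vertex_split (G \<boxtimes> H) s d (g0, h0) (g0, h1) R"
  proof (intro vertex_split.intro bound zero cross descend)
    show "pair_graph (G \<boxtimes> H)" using assms(1,2) by (rule pair_graph_strong_product)
    show "((g0, h0), (g0, h1)) \<in> parcs (G \<boxtimes> H)" using H.child G.root_in by (simp add: arc)
    show "s (g0, h0)" "\<not> s (g0, h1)"
      using diff G.depth_root H.depth_root by (auto simp: s_def)
  qed
  then show ?thesis by blast
qed

subsection \<open>Radius and rainbow colorings\<close>

lemma radius_le_eccentricity:
  assumes "finite (pverts X)" "v \<in> pverts X"
  shows "radius X \<le> eccentricity X v"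
  unfolding radius_def using assms by (auto intro!: Min_le)

lemma eccentricity_attained:
  assumes "finite (pverts X)" "v \<in> pverts X"
  shows "\<exists>u\<in>pverts X. eccentricity X v = graph_dist X v u"
proof -
  have "Max {graph_dist X v u | u. u \<in> pverts X} \<in> {graph_dist X v u | u. u \<in> pverts X}"
    using assms by (intro Max_in) auto
  then show ?thesis by (auto simp: eccentricity_def)
qed

lemma exists_center:
  assumes "finite (pverts X)" "pverts X \<noteq> {}"
  obtains v where "v \<in> pverts X" "\<And>u. u \<in> pverts X \<Longrightarrow> graph_dist X v u \<le> radius X"
proof -
  have "Min {eccentricity X v | v. v \<in> pverts X} \<in> {eccentricity X v | v. v \<in> pverts X}"
    using assms by (intro Min_in) auto
  then obtain v where v: "v \<in> pverts X" "radius X = eccentricity X v"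
    by (auto simp: radius_def)
  have "graph_dist X v u \<le> eccentricity X v" if "u \<in> pverts X" for u
    unfolding eccentricity_def using assms that by (auto intro!: Max_ge)
  then show thesis using that v by simp
qed

text \<open>A rainbow path has as many colors as edges, and a path to a farthest vertex has at least
  \<open>radius X\<close> edges.\<close>

lemma radius_le_card_rainbow_coloring:
  assumes "pair_graph X" "pverts X \<noteq> {}" "rainbow_coloring X c"
  shows "radius X \<le> card (c ` edges X)"
proof -
  interpret pair_graph X by fact
  obtain v where v: "v \<in> pverts X" using assms(2) by blast
  obtain u where u: "u \<in> pverts X" "eccentricity X v = graph_dist X v u"
    using eccentricity_attained[OF pair_finite_verts v] by blast
  obtain p where p: "apath v p u" "distinct (map (\<lambda>(x, y). c {x, y}) p)"
    using assms(3) u(1) v unfolding rainbow_coloring_def rainbow_path_def by blast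
  have "edges X \<subseteq> Pow (pverts X)" by (auto simp: edges_def dest: in_arcsD1 in_arcsD2)
  then have fin: "finite (edges X)" using pair_finite_verts by (meson finite_Pow_iff finite_subset)
  have "set p \<subseteq> parcs X" using p(1) by (auto simp: apath_def)
  then have "set (map (\<lambda>(x, y). c {x, y}) p) \<subseteq> c ` edges X" by (fastforce simp: edges_def)
  then have "card (set (map (\<lambda>(x, y). c {x, y}) p)) \<le> card (c ` edges X)"
    using fin by (intro card_mono finite_imageI)
  then have "length p \<le> card (c ` edges X)" using distinct_card[OF p(2)] by simp
  then show ?thesis
    using radius_le_eccentricity[OF pair_finite_verts v] graph_dist_le[OF p(1)] u(2) by linarith
qed

lemma nontrivial_obtains_other:
  assumes "\<not> trivial_graph G"
  obtains x where "x \<in> pverts G" "x \<noteq> g"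
proof -
  have "\<not> pverts G \<subseteq> {g}"
    using assms by (auto simp: trivial_graph_def subset_singleton_iff)
  then show thesis using that by blast
qed

theorem theorem4:
  fixes G' :: "'a pair_pre_digraph" and H' :: "'b pair_pre_digraph"
  assumes "pair_graph G'" and "Digraph_Component.connected (with_proj G')" and "\<not> trivial_graph G'"
    and "pair_graph H'" and "Digraph_Component.connected (with_proj H')" and "\<not> trivial_graph H'"
  shows "radius (G' \<boxtimes> H') \<le> rainbow_connection_number (G' \<boxtimes> H') \<and>
    rainbow_connection_number (G' \<boxtimes> H') \<le> 2 * radius (G' \<boxtimes> H') + 2"
proof -
  let ?X = "G' \<boxtimes> H'" and ?R = "radius (G' \<boxtimes> H')"
  interpret G: pair_graph G' by fact
  interpret H: pair_graph H' by fact
  interpret X: pair_graph ?X using assms(1,4) by (rule pair_graph_strong_product)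
  have ne: "pverts ?X \<noteq> {}"
    using nontrivial_obtains_other[OF assms(3)] nontrivial_obtains_other[OF assms(6)]
    by (metis SigmaI empty_iff pverts_strong_product)
  obtain v0 where v0: "v0 \<in> pverts ?X"
    "\<And>u. u \<in> pverts ?X \<Longrightarrow> graph_dist ?X v0 u \<le> ?R"
    using exists_center[OF X.pair_finite_verts ne] by blast
  obtain g0 h0 where "v0 = (g0, h0)" by fastforce
  with v0 have c: "g0 \<in> pverts G'" "h0 \<in> pverts H'"
    "\<And>u. u \<in> pverts ?X \<Longrightarrow> graph_dist ?X (g0, h0) u \<le> ?R"
    by auto
  \<comment> \<open>Project a shortest path from the center to each factor.\<close>
  have reach: "(\<exists>n\<le>?R. (g0, g) \<in> parcs G' ^^ n) \<and> (\<exists>n\<le>?R. (h0, h) \<in> parcs H' ^^ n)"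
    if gh: "g \<in> pverts G'" "h \<in> pverts H'" for g h
  proof -
    have "((g0, h0), (g, h)) \<in> (parcs ?X)\<^sup>*"
      using assms c(1,2) gh by (intro rtrancl_strong_product rtrancl_of_connected)
    then obtain p where p: "X.apath (g0, h0) p (g, h)" "length p = graph_dist ?X (g0, h0) (g, h)"
      using apath_length_graph_dist[OF X.pair_wf_digraph, of "(g0, h0)" "(g, h)"] c(1,2) by auto
    then have "((g0, h0), (g, h)) \<in> parcs ?X ^^ length p"
      by (intro relpow_of_awalk X.pair_wf_digraph) (auto simp: X.apath_def)
    note relpow_strong_product[OF this]
    moreover have "length p \<le> ?R" using p(2) c(3)[of "(g, h)"] gh by simp
    ultimately show ?thesis by (meson le_trans)
  qed
  \<comment> \<open>A second vertex ensures that layer 1 is nonempty.\<close>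
  obtain x where x: "x \<in> pverts G'" "x \<noteq> g0" using nontrivial_obtains_other assms(3) .
  have "parcs G' \<subseteq> pverts G' \<times> pverts G'" "sym (parcs G')"
    by (auto dest: G.in_arcsD1 G.in_arcsD2 G.arcs_symmetric intro: symI)
  then obtain g1 i p where lG: "rooted_layers (pverts G') (parcs G') ?R g0 g1 i p"
    by (rule rooted_layers_exists[OF _ _ c(1) x]) (use reach c(2) in auto)
  obtain y where y: "y \<in> pverts H'" "y \<noteq> h0" using nontrivial_obtains_other assms(6) .
  have "parcs H' \<subseteq> pverts H' \<times> pverts H'" "sym (parcs H')"
    by (auto dest: H.in_arcsD1 H.in_arcsD2 H.arcs_symmetric intro: symI)
  then obtain h1 j q where lH: "rooted_layers (pverts H') (parcs H') ?R h0 h1 j q"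
    by (rule rooted_layers_exists[OF _ _ c(2) y]) (use reach c(1) in auto)
  obtain s d where "vertex_split ?X s d (g0, h0) (g0, h1) ?R"
    using strong_product_vertex_split[OF assms(1,4) lG lH] by blast
  then obtain f :: "('a \<times> 'b) set \<Rightarrow> nat"
    where f: "rainbow_coloring ?X f" "card (f ` edges ?X) \<le> 2 * ?R + 2"
    using vertex_split.exists_rainbow_coloring[of ?X s d "(g0, h0)" "(g0, h1)" ?R] by blast
  let ?P = "\<lambda>k. \<exists>c :: ('a \<times> 'b) set \<Rightarrow> nat. rainbow_coloring ?X c \<and> card (c ` edges ?X) = k"
  \<comment> \<open>The coloring \<open>f\<close> shows that the \<open>LEAST\<close> is attained,
    so the lower bound applies to an optimal coloring.\<close>
  have "?P (rainbow_connection_number ?X)"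
    unfolding rainbow_connection_number_def by (rule LeastI_ex) (use f(1) in blast)
  then have "?R \<le> rainbow_connection_number ?X"
    using radius_le_card_rainbow_coloring[OF X.pair_graph ne] by metis
  moreover have "rainbow_connection_number ?X \<le> card (f ` edges ?X)"
    unfolding rainbow_connection_number_def by (rule Least_le) (use f(1) in blast)
  ultimately show ?thesis using f(2) by linarith
qed

end
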